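(* Let $n, g \ge 1$ be integers. Let $f:\mathbb{R}^n\to\mathbb{R}$ be a polynomial function of degree at most $g-1$ and let $P:\mathbb{R}^n\to\mathbb{R}$ be a polynomial function such that for every $\vec a\in\mathbb{R}^n$, $P(\vec a)=0$ implies $f(\vec a)=0$. If there exists a line $\vec r:\mathbb{R}\to\mathbb{R}^n$, $\vec r(k)=\vec a_0 k+\vec b_0$ with $\vec a_0,\vec b_0\in\mathbb{R}^n$, such that the one-variable real polynomial $k\mapsto P(\vec r(k))$ has (at least) $g$ distinct real roots each of multiplicity one, then $f(\vec a)=0$ for every $\vec a\in\mathbb{R}^n$.
   Context: Degree means total degree of a real polynomial in $n$ variables. A single root of a one-variable polynomial is a root of multiplicity exactly one. *)

theory Defs
  imports "HOL-Analysis.Analysis" "HOL-Library.Poly_Mapping"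
    "HOL-Computational_Algebra.Polynomial"
begin

text \<open>
  Real polynomials in the variables indexed by \<open>'n\<close> (so in \<open>CARD('n)\<close> variables): finitely
  supported families of coefficients, indexed by the exponents of the monomials.
\<close>

type_synonym 'n real_mpoly = "('n \<Rightarrow>\<^sub>0 nat) \<Rightarrow>\<^sub>0 real"

definition mpoly_eval :: "'n::finite real_mpoly \<Rightarrow> real ^ 'n \<Rightarrow> real" where
  "mpoly_eval p x = (\<Sum>m\<in>Poly_Mapping.keys p.
     Poly_Mapping.lookup p m * (\<Prod>i\<in>UNIV. (x $ i) ^ Poly_Mapping.lookup m i))"

text \<open>The zero polynomial gets total degree 0, so it satisfies every bound on the total degree.\<close>

definition total_degree :: "'n::finite real_mpoly \<Rightarrow> nat" where
  "total_degree p = Max (insert 0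
     ((\<lambda>m. \<Sum>i\<in>UNIV. Poly_Mapping.lookup m i) ` Poly_Mapping.keys p))"

text \<open>\<open>order k 0\<close> is unspecified, hence the condition \<open>q \<noteq> 0\<close>.\<close>

definition single_root :: "real poly \<Rightarrow> real \<Rightarrow> bool" where
  "single_root q k \<longleftrightarrow> q \<noteq> 0 \<and> order k q = 1"

lemma mpoly_eval_superset:
  assumes "finite S" "Poly_Mapping.keys p \<subseteq> S"
  shows "mpoly_eval p x =
    (\<Sum>m\<in>S. Poly_Mapping.lookup p m * (\<Prod>i\<in>UNIV. (x $ i) ^ Poly_Mapping.lookup m i))"
  unfolding mpoly_eval_def
  using assms by (intro sum.mono_neutral_left) (auto simp: in_keys_iff)

lemma mpoly_eval_add: "mpoly_eval (p + q) x = mpoly_eval p x + mpoly_eval q x"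
proof -
  let ?S = "Poly_Mapping.keys p \<union> Poly_Mapping.keys q"
  show ?thesis
    using Poly_Mapping.keys_add[of p q]
    by (simp add: mpoly_eval_superset[of ?S] lookup_add algebra_simps sum.distrib)
qed

lemma mpoly_eval_zero [simp]: "mpoly_eval 0 x = 0"
  by (simp add: mpoly_eval_def)

lemma mpoly_eval_sum: "mpoly_eval (sum p S) x = (\<Sum>s\<in>S. mpoly_eval (p s) x)"
  by (induction S rule: infinite_finite_induct) (auto simp: mpoly_eval_add)

lemma mpoly_eval_single:
  "mpoly_eval (Poly_Mapping.single m c) x = c * (\<Prod>i\<in>UNIV. (x $ i) ^ Poly_Mapping.lookup m i)"
  by (cases "c = 0") (auto simp: mpoly_eval_def)

lemma mpoly_sum_single:
  "p = (\<Sum>m\<in>Poly_Mapping.keys p. Poly_Mapping.single m (Poly_Mapping.lookup p m))"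
  by (rule poly_mapping_eqI)
     (auto simp: lookup_sum lookup_single when_def in_keys_iff)

lemma mpoly_eval_mult: "mpoly_eval (p * q) x = mpoly_eval p x * mpoly_eval q x"
proof -
  have "p * q = (\<Sum>a\<in>Poly_Mapping.keys p. \<Sum>b\<in>Poly_Mapping.keys q.
      Poly_Mapping.single (a + b) (Poly_Mapping.lookup p a * Poly_Mapping.lookup q b))"
    by (subst mpoly_sum_single[of p], subst mpoly_sum_single[of q])
       (simp add: sum_product mult_single)
  then have "mpoly_eval (p * q) x = (\<Sum>a\<in>Poly_Mapping.keys p. \<Sum>b\<in>Poly_Mapping.keys q.
      Poly_Mapping.lookup p a * Poly_Mapping.lookup q b *
      ((\<Prod>i\<in>UNIV. (x $ i) ^ Poly_Mapping.lookup a i) *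
       (\<Prod>i\<in>UNIV. (x $ i) ^ Poly_Mapping.lookup b i)))"
    by (simp add: mpoly_eval_sum mpoly_eval_single lookup_add power_add prod.distrib)
  then show ?thesis
    by (simp add: mpoly_eval_def sum_product mult_ac)
qed

lemma real_polynomial_function_iff_mpoly_eval:
  "real_polynomial_function f \<longleftrightarrow> (\<exists>p. f = mpoly_eval p)"
proof
  assume "real_polynomial_function f"
  then show "\<exists>p. f = mpoly_eval p"
  proof (induction rule: real_polynomial_function.induct)
    case (linear f)
    define p where "p = (\<Sum>i\<in>UNIV. Poly_Mapping.single (Poly_Mapping.single i (1::nat)) (f (axis i 1)))"
    have "f x = mpoly_eval p x" for x
    proof -
      have "(\<Prod>j\<in>UNIV. (x $ j) ^ Poly_Mapping.lookup (Poly_Mapping.single i (1::nat)) j) = x $ i" for i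
        by (simp add: lookup_single when_def if_distrib cong: if_cong)
      then have "mpoly_eval p x = (\<Sum>i\<in>UNIV. f (axis i 1) * x $ i)"
        by (simp add: p_def mpoly_eval_sum mpoly_eval_single)
      also have "\<dots> = (\<Sum>i\<in>UNIV. f ((x $ i) *\<^sub>R axis i 1))"
        using linear by (simp add: linear_simps(5) mult.commute)
      also have "\<dots> = f (\<Sum>i\<in>UNIV. (x $ i) *\<^sub>R axis i 1)"
        using linear by (simp add: bounded_linear.linear linear_sum)
      also have "(\<Sum>i\<in>UNIV. (x $ i) *\<^sub>R axis i 1) = x"
        by (simp add: basis_expansion scalar_mult_eq_scaleR[symmetric])
      finally show ?thesis ..
    qed
    then show ?case by blast
  next
    case (const c)
    have "(\<lambda>x. c) = mpoly_eval (Poly_Mapping.single 0 c)"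
      by (simp add: fun_eq_iff mpoly_eval_single)
    then show ?case by blast
  next
    case (add f g)
    then obtain p q where "f = mpoly_eval p" "g = mpoly_eval q" by blast
    then have "(\<lambda>x. f x + g x) = mpoly_eval (p + q)"
      by (simp add: fun_eq_iff mpoly_eval_add)
    then show ?case by blast
  next
    case (mult f g)
    then obtain p q where "f = mpoly_eval p" "g = mpoly_eval q" by blast
    then have "(\<lambda>x. f x * g x) = mpoly_eval (p * q)"
      by (simp add: fun_eq_iff mpoly_eval_mult)
    then show ?case by blast
  qed
next
  have "real_polynomial_function (\<lambda>x. x $ i)" for i :: 'a
    by (rule real_polynomial_function.intros(1)) (rule bounded_linear_vec_nth)
  then have "real_polynomial_function (mpoly_eval p)" for p :: "'a real_mpoly"
    unfolding mpoly_eval_def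
    by (intro real_polynomial_function_sum real_polynomial_function.intros(2,4)
        real_polynomial_function_prod real_polynomial_function_power) auto
  then show "\<exists>p. f = mpoly_eval p \<Longrightarrow> real_polynomial_function f"
    by auto
qed

end

theory Submission
  imports Defs
begin

text \<open>
  A simple root of a real polynomial is a zero at which its sign changes, and a sign change
  is stable: if the line \<open>k \<mapsto> k *\<^sub>R a0 + b0\<close> is translated by moving \<open>b0\<close> to a nearby \<open>b\<close>, then
  near each simple root of \<open>P\<close> on the old line the intermediate value theorem still yields a zero
  of \<open>P\<close> on the new one (\<open>eventually_zeros_on_translated_line\<close>).  Hence \<open>P\<close>, and with it \<open>f\<close>, has at
  least \<open>g\<close> zeros on the translated line.  The restriction of \<open>f\<close> to a line is a one-variable
  polynomial of degree at most \<open>g - 1\<close>, so it vanishes identically; its value at \<open>k = 0\<close> is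
  \<open>f b = 0\<close>.  As \<open>b\<close> was any point near \<open>b0\<close>, \<open>f\<close> vanishes on a neighbourhood of \<open>b0\<close>, and a
  polynomial function with that property is zero (\<open>mpoly_eval_eq_0_of_eventually\<close>).

  Only the base point of the line is moved, never its direction, because the values at \<open>k = 0\<close>
  of these translates already fill a neighbourhood.
\<close>

definition restrict_line :: "'n::finite real_mpoly \<Rightarrow> real ^ 'n \<Rightarrow> real ^ 'n \<Rightarrow> real poly" where
  "restrict_line F a b = (\<Sum>m\<in>Poly_Mapping.keys F.
     Polynomial.smult (Poly_Mapping.lookup F m) (\<Prod>i\<in>UNIV. [:b $ i, a $ i:] ^ Poly_Mapping.lookup m i))"

lemma poly_restrict_line: "poly (restrict_line F a b) k = mpoly_eval F (k *\<^sub>R a + b)"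
  by (simp add: restrict_line_def mpoly_eval_def poly_sum poly_prod algebra_simps)

lemma degree_restrict_line_le: "degree (restrict_line F a b) \<le> total_degree F"
  unfolding restrict_line_def
proof (rule degree_sum_le)
  fix m assume m: "m \<in> Poly_Mapping.keys F"
  let ?p = "\<lambda>i. [:b $ i, a $ i:] ^ Poly_Mapping.lookup m i"
  have "degree (Polynomial.smult (Poly_Mapping.lookup F m) (\<Prod>i\<in>UNIV. ?p i)) \<le> degree (\<Prod>i\<in>UNIV. ?p i)"
    by (rule degree_smult_le)
  also have "\<dots> \<le> (\<Sum>i\<in>UNIV. degree (?p i))"
    using degree_prod_sum_le[of UNIV ?p] by (simp add: o_def)
  also have "\<dots> \<le> (\<Sum>i\<in>UNIV. Poly_Mapping.lookup m i)"
  proof (rule sum_mono)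
    fix i
    have "degree (?p i) \<le> degree [:b $ i, a $ i:] * Poly_Mapping.lookup m i"
      by (rule degree_power_le)
    also have "\<dots> \<le> 1 * Poly_Mapping.lookup m i"
      by (intro mult_right_mono) auto
    finally show "degree (?p i) \<le> Poly_Mapping.lookup m i" by simp
  qed
  also have "\<dots> \<le> total_degree F"
    unfolding total_degree_def using m by (intro Max_ge) auto
  finally show "degree (Polynomial.smult (Poly_Mapping.lookup F m) (\<Prod>i\<in>UNIV. ?p i)) \<le> total_degree F" .
qed simp

text \<open>
  Any point \<open>a\<close> lies on a line through \<open>b\<close>, and that line meets the neighbourhood of \<open>b\<close> where
  \<open>F\<close> vanishes in infinitely many points.
\<close>

lemma mpoly_eval_eq_0_of_eventually:
  assumes "\<forall>\<^sub>F x in nhds b. mpoly_eval F x = 0"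
  shows "mpoly_eval F a = 0"
proof -
  let ?r = "restrict_line F (a - b) b"
  have "((\<lambda>k. k *\<^sub>R (a - b) + b) \<longlongrightarrow> 0 *\<^sub>R (a - b) + b) (nhds 0)"
    by (intro tendsto_intros filterlim_ident)
  then have "\<forall>\<^sub>F k in nhds 0. mpoly_eval F (k *\<^sub>R (a - b) + b) = 0"
    using assms unfolding filterlim_iff scaleR_zero_left add_0 by blast
  then have "\<forall>\<^sub>F k in nhds 0. poly ?r k = 0"
    by (simp add: poly_restrict_line)
  then obtain T where T: "open T" "0 \<in> T" "\<And>k. k \<in> T \<Longrightarrow> poly ?r k = 0"
    by (auto simp: eventually_nhds)
  have "infinite T"
    using T(1,2) finite_imp_not_open by blast
  then have "infinite {k. poly ?r k = 0}"
    using T(3) by (meson finite_subset mem_Collect_eq subsetI)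
  then have "?r = 0"
    using poly_roots_finite by blast
  then show ?thesis
    using poly_restrict_line[of F "a - b" b 1] by simp
qed

text \<open>
  Write the polynomial as \<open>[:-c, 1:] * r\<close> with \<open>poly r c \<noteq> 0\<close>: near \<open>c\<close> the cofactor keeps its sign,
  while the linear factor changes its own.
\<close>

lemma single_root_sign_change:
  assumes "single_root q c" "e > 0"
  obtains d where "0 < d" "d < e" "poly q (c - d) * poly q (c + d) < 0"
proof -
  from assms(1) obtain r where r: "q = [:-c, 1:] * r" "\<not> [:-c, 1:] dvd r"
    using order_decomp[of q c] by (auto simp: single_root_def)
  then have "poly r c \<noteq> 0"
    by (simp add: poly_eq_0_iff_dvd)
  then have "poly r (c - 0) * poly r (c + 0) > 0"
    by (auto simp: zero_less_mult_iff)
  moreover have "((\<lambda>d. poly r (c - d) * poly r (c + d)) \<longlongrightarrow> poly r (c - 0) * poly r (c + 0)) (at_right 0)"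
    by (intro tendsto_intros)
  ultimately have "\<forall>\<^sub>F d in at_right 0. poly r (c - d) * poly r (c + d) > 0"
    by (rule order_tendstoD(1)[rotated])
  moreover have "\<forall>\<^sub>F d in at_right 0. 0 < d \<and> d < e"
    using eventually_at_right_real[OF assms(2)] by simp
  ultimately have "\<forall>\<^sub>F d in at_right 0. poly r (c - d) * poly r (c + d) > 0 \<and> 0 < d \<and> d < e"
    by (rule eventually_conj)
  then obtain d where d: "poly r (c - d) * poly r (c + d) > 0" "0 < d" "d < e"
    using eventually_happens'[OF trivial_limit_at_right_real] by blast
  have "poly q (c - d) * poly q (c + d) = - (d * d) * (poly r (c - d) * poly r (c + d))"
    by (simp add: r(1) algebra_simps)
  also have "\<dots> < 0"
    using d by (intro mult_neg_pos) auto
  finally show ?thesis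
    using that d by blast
qed

lemma sign_change_imp_zero:
  fixes h :: "real \<Rightarrow> real"
  assumes "continuous_on {s..t} h" "s \<le> t" "h s * h t < 0"
  obtains k where "s \<le> k" "k \<le> t" "h k = 0"
proof -
  have "0 \<in> closed_segment (h s) (h t)"
    using assms(3) by (auto simp: closed_segment_eq_real_ivl mult_less_0_iff)
  then show ?thesis
    using IVT'_closed_segment_real[of 0 h s t] assms that
    by (auto simp: closed_segment_eq_real_ivl)
qed

text \<open>
  The strict inequality that expresses the sign change involves only two points of the line, so
  by continuity it survives a small translation.
\<close>

lemma eventually_zero_near_single_root:
  fixes P :: "'a::real_normed_vector \<Rightarrow> real"
  assumes P: "continuous_on UNIV P" and q: "\<And>k. poly q k = P (k *\<^sub>R a + b0)"
    and c: "single_root q c" and "e > 0"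
  shows "\<forall>\<^sub>F b in nhds b0. \<exists>k. \<bar>k - c\<bar> < e \<and> P (k *\<^sub>R a + b) = 0"
proof -
  obtain d where d: "0 < d" "d < e" "poly q (c - d) * poly q (c + d) < 0"
    using single_root_sign_change[OF c \<open>e > 0\<close>] .
  have translate: "((\<lambda>b. P (k *\<^sub>R a + b)) \<longlongrightarrow> P (k *\<^sub>R a + b0)) (nhds b0)" for k
  proof (rule continuous_on_tendsto_compose[OF P])
    show "((\<lambda>b. k *\<^sub>R a + b) \<longlongrightarrow> k *\<^sub>R a + b0) (nhds b0)"
      by (intro tendsto_intros filterlim_ident)
  qed auto
  then have "\<forall>\<^sub>F b in nhds b0. P ((c - d) *\<^sub>R a + b) * P ((c + d) *\<^sub>R a + b) < 0"
    using order_tendstoD(2)[OF tendsto_mult[OF translate translate]] d(3) unfolding q by blast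
  then show ?thesis
  proof (rule eventually_mono)
    fix b assume b: "P ((c - d) *\<^sub>R a + b) * P ((c + d) *\<^sub>R a + b) < 0"
    have "continuous_on {c - d..c + d} (\<lambda>k. P (k *\<^sub>R a + b))"
      by (intro continuous_on_compose2[OF P] continuous_intros) auto
    then obtain k where "c - d \<le> k" "k \<le> c + d" "P (k *\<^sub>R a + b) = 0"
      using sign_change_imp_zero[of "c - d" "c + d" "\<lambda>k. P (k *\<^sub>R a + b)"] b d(1) by auto
    then show "\<exists>k. \<bar>k - c\<bar> < e \<and> P (k *\<^sub>R a + b) = 0"
      using d(2) by (intro exI[of _ k]) auto
  qed
qed

text \<open>
  Zeros that come from different simple roots are different, provided that each of them is
  closer to its root than half the smallest distance between two of the roots.
\<close>

lemma eventually_zeros_on_translated_line: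
  fixes P :: "'a::real_normed_vector \<Rightarrow> real"
  assumes P: "continuous_on UNIV P" and q: "\<And>k. poly q k = P (k *\<^sub>R a + b0)"
    and S: "finite S" "\<And>c. c \<in> S \<Longrightarrow> single_root q c"
  shows "\<forall>\<^sub>F b in nhds b0. \<exists>Z. card Z = card S \<and> (\<forall>k\<in>Z. P (k *\<^sub>R a + b) = 0)"
proof -
  have "uniform_discrete S"
    using S(1) uniform_discrete_finite_iff by blast
  then obtain e where e: "e > 0" "\<And>x y. x \<in> S \<Longrightarrow> y \<in> S \<Longrightarrow> dist x y < e \<Longrightarrow> x = y"
    by (auto simp: uniform_discrete_def)
  have "\<forall>\<^sub>F b in nhds b0. \<forall>c\<in>S. \<exists>k. \<bar>k - c\<bar> < e / 2 \<and> P (k *\<^sub>R a + b) = 0"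
    using S e(1) by (intro eventually_ball_finite ballI eventually_zero_near_single_root[OF P q]) auto
  then show ?thesis
  proof (rule eventually_mono)
    fix b assume "\<forall>c\<in>S. \<exists>k. \<bar>k - c\<bar> < e / 2 \<and> P (k *\<^sub>R a + b) = 0"
    then obtain z where z: "\<And>c. c \<in> S \<Longrightarrow> \<bar>z c - c\<bar> < e / 2" "\<And>c. c \<in> S \<Longrightarrow> P (z c *\<^sub>R a + b) = 0"
      by metis
    have "inj_on z S"
    proof (rule inj_onI)
      fix x y assume xy: "x \<in> S" "y \<in> S" "z x = z y"
      have "dist x y < e"
        using z(1)[OF xy(1)] z(1)[OF xy(2)] xy(3) unfolding dist_real_def by linarith
      then show "x = y"
        using e(2) xy by blast
    qed
    then show "\<exists>Z. card Z = card S \<and> (\<forall>k\<in>Z. P (k *\<^sub>R a + b) = 0)"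
      using z(2) by (intro exI[of _ "z ` S"]) (auto simp: card_image)
  qed
qed

theorem theorem1p1:
  fixes f P :: "real ^ 'n \<Rightarrow> real" and g :: nat
  assumes "g \<ge> 1"
    and "\<exists>F. f = mpoly_eval F \<and> total_degree F \<le> g - 1"
    and "real_polynomial_function P"
    and "\<And>a. P a = 0 \<Longrightarrow> f a = 0"
    and "\<exists>(a0 :: real ^ 'n) b0. \<exists>q :: real poly.
           (\<forall>k. poly q k = P (k *\<^sub>R a0 + b0)) \<and> g \<le> card {k. single_root q k}"
  shows "\<forall>a. f a = 0"
proof
  fix a
  obtain F where F: "f = mpoly_eval F" "total_degree F \<le> g - 1"
    using assms(2) by blast
  obtain a0 b0 :: "real ^ 'n" and q where q: "\<And>k. poly q k = P (k *\<^sub>R a0 + b0)"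
    and card: "g \<le> card {k. single_root q k}"
    using assms(5) by blast
  have "finite {k. single_root q k}"
    using assms(1) card by (intro card_ge_0_finite) linarith
  moreover have "continuous_on UNIV P"
    using assms(3) by (intro continuous_on_polymonial_function) (simp add: real_polynomial_function_eq)
  ultimately have "\<forall>\<^sub>F b in nhds b0. \<exists>Z. card Z = card {k. single_root q k} \<and> (\<forall>k\<in>Z. P (k *\<^sub>R a0 + b) = 0)"
    using q by (intro eventually_zeros_on_translated_line) auto
  then have "\<forall>\<^sub>F b in nhds b0. mpoly_eval F b = 0"
  proof (rule eventually_mono)
    fix b assume "\<exists>Z. card Z = card {k. single_root q k} \<and> (\<forall>k\<in>Z. P (k *\<^sub>R a0 + b) = 0)"
    then obtain Z where Z: "card Z = card {k. single_root q k}" "\<And>k. k \<in> Z \<Longrightarrow> P (k *\<^sub>R a0 + b) = 0"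
      by blast
    have "poly (restrict_line F a0 b) k = poly 0 k" if "k \<in> Z" for k
      using assms(4)[OF Z(2)[OF that]] F(1) by (simp add: poly_restrict_line)
    moreover have "degree (restrict_line F a0 b) < card Z"
      using degree_restrict_line_le[of F a0 b] F(2) Z(1) card assms(1) by linarith
    ultimately have "restrict_line F a0 b = 0"
      using poly_eqI_degree[of Z "restrict_line F a0 b" 0] by fastforce
    then show "mpoly_eval F b = 0"
      using poly_restrict_line[of F a0 b 0] by simp
  qed
  then show "f a = 0"
    using mpoly_eval_eq_0_of_eventually F(1) by blast
qed

end
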